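(* Let $\mathcal P=\{\mathcal P_1,\ldots,\mathcal P_n\}$ be the uniform partitions, with $m_1,\ldots,m_n$ intervals respectively, associated to a sample of size $N$ of $(X_1,\ldots,X_n)^T$, and let $\widetilde c$ be the corresponding sample derivated copula distribution. Then the information content of the joint probability distribution determined by the partition $\mathcal P$ is \[ I_{\mathcal P}(X_1,\ldots,X_n)=\sum_{i=1}^n\log_2 m_i+\sum_{j_1=1}^{m_1}\cdots\sum_{j_n=1}^{m_n}\widetilde c\left(u^1_{j_1},\ldots,u^n_{j_n}\right)\log_2\widetilde c\left(u^1_{j_1},\ldots,u^n_{j_n}\right), \] so that, for given numbers of intervals $m_1,\ldots,m_n$, it depends only on the sample derivated copula.
   Context: Sample: $X_1,\ldots,X_n$ are continuous random variables and $(x_1^r,\ldots,x_n^r)$, $r=1,\ldots,N$, is a sample of size $N$ from their joint distribution, such that for each $i$ the values $x_i^1,\ldots,x_i^N$ are pairwise distinct; $\Lambda_i=\{x_i^1,\ldots,x_i^N\}$. Let $\lambda_i^m$ and $\lambda_i^M$ be the (real) minimum and maximum of the theoretical range of $X_i$; it is assumed that $\lambda_i^m<\min\Lambda_i$ and $\max\Lambda_i<\lambda_i^M$. Uniform partition: for each $i$, $m_i$ is a positive integer dividing $N$, and $\mathcal P_i=\{x_0^{p_i}=\lambda_i^m<x_1^{p_i}<\cdots<x_{m_i}^{p_i}=\lambda_i^M\}$ is such that each interval $(x_{j-1}^{p_i};x_j^{p_i}]$, $j=1,\ldots,m_i$, contains exactly $n_i=N/m_i$ elements of $\Lambda_i$,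 and $x_j^{p_i}\in\Lambda_i$ for $j=1,\ldots,m_i-1$. Transformed sample: put $u_j^i=j/m_i$, $j=0,\ldots,m_i$, and $\widetilde\Lambda_i=\{u_0^i,\ldots,u_{m_i}^i\}$. Each value of $X_i$ in $(x_{j-1}^{p_i};x_j^{p_i}]$ is replaced by $u_j^i$. The resulting collection of $N$ vectors, counted with multiplicity, is denoted $\mathcal T$. Sample derivated copula distribution: $\widetilde c:\prod_{i=1}^n\widetilde\Lambda_i\to\mathbb R$, where $\widetilde c(u_{k_1}^1,\ldots,u_{k_n}^n)$ is the number of elements of $\mathcal T$ (with multiplicity) equal to $(u_{k_1}^1,\ldots,u_{k_n}^n)$, divided by $N$. Information content: the probabilities determined by the partition are the sample relative frequencies. $H_{\mathcal P_i}(X_i)$ is the Shannon entropy $-\sum_{j=1}^{m_i}p^i_j\log_2p^i_j$, where $p^i_j$ is the proportion of sample elements whose $i$-th coordinate lies in $(x_{j-1}^{p_i};x_j^{p_i}]$. $H_{\mathcal P}(X_1,\ldots,X_n)=-\sum_{j_1=1}^{m_1}\cdots\sum_{j_n=1}^{m_n}p_{j_1,\ldots,j_n}\log_2p_{j_1,\ldots,j_n}$, where $p_{j_1,\ldots,j_n}$ is the proportion of sample elements lying in $\prod_{i=1}^n(x_{j_i-1}^{p_i};x_{j_i}^{p_i}]$. The information content is $I_{\mathcal P}(X_1,\ldots,X_n)=\sum_{i=1}^nH_{\mathcal P_i}(X_i)-H_{\mathcal P}(X_1,\ldots,X_n)$. Convention: $0\log_2 0=0$. *)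

theory Defs
  imports "HOL-Probability.Probability" "HOL-Library.Multiset"
begin

text \<open>Coordinates are indexed by \<open>i \<in> {1..n}\<close> and sample points by \<open>r \<in> {1..N}\<close>;
  \<open>x r i\<close> is the \<open>i\<close>-th coordinate of the \<open>r\<close>-th sample point, and \<open>q i j\<close> is the \<open>j\<close>-th
  point of the partition of the \<open>i\<close>-th axis.  Index tuples and vectors are elements of
  \<open>PiE {1..n} _\<close>, so an \<open>n\<close>-fold sum is one sum over a \<open>PiE\<close> set.\<close>

text \<open>A random variable is continuous when its distribution function is; a density is not
  required.\<close>

definition continuous_random_variable :: "'a measure \<Rightarrow> ('a \<Rightarrow> real) \<Rightarrow> bool" where
  "continuous_random_variable M X \<longleftrightarrow>
     X \<in> borel_measurable M \<and> continuous_on UNIV (cdf (distr M borel X))"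

text \<open>The theoretical range is the support of the distribution, not the image of the sample
  space, which depends on null sets.\<close>

definition theoretical_range :: "'a measure \<Rightarrow> ('a \<Rightarrow> real) \<Rightarrow> real set" where
  "theoretical_range M X =
     {a. \<forall>e>0. measure (distr M borel X) {a - e <..< a + e} > 0}"

text \<open>Realization of \<open>N\<close> independent draws from the joint distribution: \<open>\<omega>\<close> is an outcome in
  the \<open>N\<close>-fold product of the underlying probability space.\<close>

definition sample_of ::
  "'a measure \<Rightarrow> nat \<Rightarrow> (nat \<Rightarrow> 'a \<Rightarrow> real) \<Rightarrow> nat \<Rightarrow> (nat \<Rightarrow> nat \<Rightarrow> real) \<Rightarrow> bool" where
  "sample_of M n X N x \<longleftrightarrow>
     (\<exists>\<omega> \<in> space (Pi\<^sub>M {1..N} (\<lambda>_. M)). \<forall>r\<in>{1..N}. \<forall>i\<in>{1..n}. x r i = X i (\<omega> r))"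

definition sample_values :: "nat \<Rightarrow> (nat \<Rightarrow> nat \<Rightarrow> real) \<Rightarrow> nat \<Rightarrow> real set" where
  "sample_values N x i = (\<lambda>r. x r i) ` {1..N}"

definition admissible_sample ::
  "'a measure \<Rightarrow> nat \<Rightarrow> (nat \<Rightarrow> 'a \<Rightarrow> real) \<Rightarrow> nat \<Rightarrow> (nat \<Rightarrow> nat \<Rightarrow> real)
     \<Rightarrow> (nat \<Rightarrow> real) \<Rightarrow> (nat \<Rightarrow> real) \<Rightarrow> bool" where
  "admissible_sample M n X N x lo hi \<longleftrightarrow>
     prob_space M \<and> sample_of M n X N x \<and>
     (\<forall>i\<in>{1..n}.
        continuous_random_variable M (X i) \<and>
        inj_on (\<lambda>r. x r i) {1..N} \<and>
        lo i \<in> theoretical_range M (X i) \<and> (\<forall>a\<in>theoretical_range M (X i). lo i \<le> a) \<and>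
        hi i \<in> theoretical_range M (X i) \<and> (\<forall>a\<in>theoretical_range M (X i). a \<le> hi i) \<and>
        lo i < Min (sample_values N x i) \<and> Max (sample_values N x i) < hi i)"

definition part_interval :: "(nat \<Rightarrow> real) \<Rightarrow> nat \<Rightarrow> real set" where
  "part_interval p j = {p (j - 1) <.. p j}"

definition uniform_partition ::
  "nat \<Rightarrow> real set \<Rightarrow> real \<Rightarrow> real \<Rightarrow> nat \<Rightarrow> (nat \<Rightarrow> real) \<Rightarrow> bool" where
  "uniform_partition N L a b k p \<longleftrightarrow>
     0 < k \<and> k dvd N \<and> p 0 = a \<and> p k = b \<and>
     (\<forall>j\<in>{1..k}. p (j - 1) < p j) \<and>
     (\<forall>j\<in>{1..k}. card (L \<inter> part_interval p j) = N div k) \<and>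
     (\<forall>j\<in>{1..<k}. p j \<in> L)"

definition uniform_partitions ::
  "nat \<Rightarrow> nat \<Rightarrow> (nat \<Rightarrow> nat \<Rightarrow> real) \<Rightarrow> (nat \<Rightarrow> real) \<Rightarrow> (nat \<Rightarrow> real)
     \<Rightarrow> (nat \<Rightarrow> nat) \<Rightarrow> (nat \<Rightarrow> nat \<Rightarrow> real) \<Rightarrow> bool" where
  "uniform_partitions n N x lo hi m q \<longleftrightarrow>
     (\<forall>i\<in>{1..n}. uniform_partition N (sample_values N x i) (lo i) (hi i) (m i) (q i))"

definition grid_point :: "nat \<Rightarrow> nat \<Rightarrow> real" where
  "grid_point k j = real j / real k"

definition grid :: "nat \<Rightarrow> real set" where
  "grid k = grid_point k ` {0..k}"

definition transformed_value :: "nat \<Rightarrow> (nat \<Rightarrow> real) \<Rightarrow> real \<Rightarrow> real" where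
  "transformed_value k p v = grid_point k (THE j. j \<in> {1..k} \<and> v \<in> part_interval p j)"

definition transformed_sample ::
  "nat \<Rightarrow> nat \<Rightarrow> (nat \<Rightarrow> nat \<Rightarrow> real) \<Rightarrow> (nat \<Rightarrow> nat) \<Rightarrow> (nat \<Rightarrow> nat \<Rightarrow> real)
     \<Rightarrow> (nat \<Rightarrow> real) multiset" where
  "transformed_sample n N x m q =
     image_mset (\<lambda>r. \<lambda>i\<in>{1..n}. transformed_value (m i) (q i) (x r i)) (mset_set {1..N})"

definition sample_derivated_copula ::
  "nat \<Rightarrow> nat \<Rightarrow> (nat \<Rightarrow> nat \<Rightarrow> real) \<Rightarrow> (nat \<Rightarrow> nat) \<Rightarrow> (nat \<Rightarrow> nat \<Rightarrow> real)
     \<Rightarrow> (nat \<Rightarrow> real) \<Rightarrow> real" where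
  "sample_derivated_copula n N x m q =
     (\<lambda>u \<in> PiE {1..n} (\<lambda>i. grid (m i)). real (count (transformed_sample n N x m q) u) / real N)"

definition marginal_freq ::
  "nat \<Rightarrow> (nat \<Rightarrow> nat \<Rightarrow> real) \<Rightarrow> (nat \<Rightarrow> nat \<Rightarrow> real) \<Rightarrow> nat \<Rightarrow> nat \<Rightarrow> real" where
  "marginal_freq N x q i j =
     real (card {r\<in>{1..N}. x r i \<in> part_interval (q i) j}) / real N"

definition joint_freq ::
  "nat \<Rightarrow> nat \<Rightarrow> (nat \<Rightarrow> nat \<Rightarrow> real) \<Rightarrow> (nat \<Rightarrow> nat \<Rightarrow> real) \<Rightarrow> (nat \<Rightarrow> nat) \<Rightarrow> real" where
  "joint_freq n N x q J =
     real (card {r\<in>{1..N}. \<forall>i\<in>{1..n}. x r i \<in> part_interval (q i) (J i)}) / real N"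

text \<open>A zero probability contributes \<open>0\<close> to the sums below, since \<open>0 * log 2 0 = 0\<close>.\<close>

definition marginal_entropy ::
  "nat \<Rightarrow> (nat \<Rightarrow> nat \<Rightarrow> real) \<Rightarrow> (nat \<Rightarrow> nat) \<Rightarrow> (nat \<Rightarrow> nat \<Rightarrow> real) \<Rightarrow> nat \<Rightarrow> real" where
  "marginal_entropy N x m q i =
     - (\<Sum>j = 1..m i. marginal_freq N x q i j * log 2 (marginal_freq N x q i j))"

definition joint_entropy ::
  "nat \<Rightarrow> nat \<Rightarrow> (nat \<Rightarrow> nat \<Rightarrow> real) \<Rightarrow> (nat \<Rightarrow> nat) \<Rightarrow> (nat \<Rightarrow> nat \<Rightarrow> real) \<Rightarrow> real" where
  "joint_entropy n N x m q =
     - (\<Sum>J \<in> PiE {1..n} (\<lambda>i. {1..m i}). joint_freq n N x q J * log 2 (joint_freq n N x q J))"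

definition information_content ::
  "nat \<Rightarrow> nat \<Rightarrow> (nat \<Rightarrow> nat \<Rightarrow> real) \<Rightarrow> (nat \<Rightarrow> nat) \<Rightarrow> (nat \<Rightarrow> nat \<Rightarrow> real) \<Rightarrow> real" where
  "information_content n N x m q =
     (\<Sum>i = 1..n. marginal_entropy N x m q i) - joint_entropy n N x m q"

end

theory Submission
  imports Defs
begin

text \<open>Each sample value lies in exactly one interval of its axis. Since the sample values of an
  axis are distinct, every interval has relative frequency \<open>1 / m\<^sub>i\<close>, so the marginal entropy is
  \<open>log 2 m\<^sub>i\<close>. A sample point lies in the cell with index \<open>J\<close> exactly when its transform is the
  corresponding grid point, so the joint frequencies are the values of the sample derivated
  copula.\<close>

lemma uniform_partition_mono:
  assumes "uniform_partition N L a b k p" "i \<le> j" "j \<le> k"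
  shows "p i \<le> p j"
  using assms(2,3)
proof (induction j rule: dec_induct)
  case (step j)
  have "p (Suc j - 1) < p (Suc j)"
    using assms(1) step.prems unfolding uniform_partition_def
    by (metis Suc_eq_plus1 atLeastAtMost_iff le_add2)
  then show ?case using step by simp
qed simp

text \<open>The least partition point at or above \<open>v\<close> is the right end of an interval
  containing \<open>v\<close>; monotonicity of the points makes different intervals
  disjoint.\<close>

lemma uniform_partition_ex1:
  assumes P: "uniform_partition N L a b k p" and v: "a < v" "v \<le> b"
  shows "\<exists>!j. j \<in> {1..k} \<and> v \<in> part_interval p j"
proof (rule ex_ex1I)
  have p: "p 0 = a" "p k = b" using P by (auto simp: uniform_partition_def)
  define j where "j = (LEAST j. v \<le> p j)"
  have le: "v \<le> p j" unfolding j_def using v(2) p(2) by (simp add: LeastI[of "\<lambda>j. v \<le> p j" k])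
  have "j \<le> k" unfolding j_def using v(2) p(2) by (simp add: Least_le)
  \<comment> \<open>Strictness of \<open>a < v\<close> matters here: the intervals are open on the
    left. With \<open>j\<close> positive, \<open>j - 1\<close> is really smaller, so minimality
    gives \<open>p (j - 1) < v\<close>.\<close>
  moreover have "j \<noteq> 0"
  proof
    assume "j = 0"
    with le v(1) p(1) show False by simp
  qed
  moreover from \<open>j \<noteq> 0\<close> have "\<not> v \<le> p (j - 1)" 
    using not_less_Least[of "j - 1" "\<lambda>j. v \<le> p j", folded j_def] by simp
  ultimately show "\<exists>j. j \<in> {1..k} \<and> v \<in> part_interval p j"
    using le by (intro exI[of _ j]) (auto simp: part_interval_def)
next
  have "\<not> i < j" if "i \<in> {1..k}" "v \<in> part_interval p i" "j \<in> {1..k}" "v \<in> part_interval p j"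
    for i j
  proof
    assume "i < j"
    \<comment> \<open>The chain \<open>v \<le> p i \<le> p (j - 1) < v\<close> is
      contradictory.\<close>
    then have "p i \<le> p (j - 1)" using that by (intro uniform_partition_mono[OF P]) auto
    with that show False by (auto simp: part_interval_def)
  qed
  then show "i = j"
    if "i \<in> {1..k} \<and> v \<in> part_interval p i" "j \<in> {1..k} \<and> v \<in> part_interval p j" for i j
    using that by (meson linorder_neqE_nat)
qed

lemma transformed_value_eq_iff:
  assumes P: "uniform_partition N L a b k p" and v: "a < v" "v \<le> b" and j: "j \<in> {1..k}"
  shows "transformed_value k p v = grid_point k j \<longleftrightarrow> v \<in> part_interval p j"
proof -
  \<comment> \<open>Here \<open>i\<close> is arbitrary, so that the index chosen by
    \<open>THE\<close> can take its place; \<open>j\<close> in \<open>{1..k}\<close> makes the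
    denominator \<open>k\<close> nonzero.\<close>
  have "grid_point k i = grid_point k j \<longleftrightarrow> i = j" for i
    using j by (auto simp: grid_point_def)
  moreover have "(THE i. i \<in> {1..k} \<and> v \<in> part_interval p i) = j \<longleftrightarrow> v \<in> part_interval p j"
    using theI'[OF uniform_partition_ex1[OF P v]] uniform_partition_ex1[OF P v] j by blast
  ultimately show ?thesis by (simp add: transformed_value_def)
qed

text \<open>The partition counts sample values, the frequency counts sample indices; injectivity
  makes the two counts equal. Divisibility turns \<open>N div k\<close> into the exact real
  quotient.\<close>

lemma marginal_freq_eq:
  assumes inj: "inj_on (\<lambda>r. x r i) {1..N}" and N: "0 < N"
    and P: "uniform_partition N (sample_values N x i) a b k (q i)" and j: "j \<in> {1..k}"
  shows "marginal_freq N x q i j = 1 / real k"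
proof -
  let ?R = "{r \<in> {1..N}. x r i \<in> part_interval (q i) j}"
  have "(\<lambda>r. x r i) ` ?R = sample_values N x i \<inter> part_interval (q i) j"
    by (auto simp: sample_values_def)
  moreover have "card ((\<lambda>r. x r i) ` ?R) = card ?R"
    by (intro card_image inj_on_subset[OF inj]) auto
  ultimately have "card ?R = N div k"
    using P j by (simp add: uniform_partition_def)
  moreover have "k dvd N" using P by (simp add: uniform_partition_def)
  ultimately show ?thesis
    using N by (simp add: marginal_freq_def real_of_nat_div)
qed

lemma marginal_entropy_eq:
  assumes "inj_on (\<lambda>r. x r i) {1..N}" "0 < N"
    and P: "uniform_partition N (sample_values N x i) a b (m i) (q i)"
  shows "marginal_entropy N x m q i = log 2 (real (m i))"
proof -
  have "0 < m i" using P by (simp add: uniform_partition_def)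
  then show ?thesis
    by (simp add: marginal_entropy_def marginal_freq_eq[where x = x and q = q and i = i, OF assms] log_divide)
qed

lemma joint_freq_eq_copula:
  assumes P: "uniform_partitions n N x lo hi m q"
    and range: "\<And>r i. r \<in> {1..N} \<Longrightarrow> i \<in> {1..n} \<Longrightarrow> lo i < x r i \<and> x r i \<le> hi i"
    and J: "J \<in> PiE {1..n} (\<lambda>i. {1..m i})"
  shows "joint_freq n N x q J =
    sample_derivated_copula n N x m q (\<lambda>i\<in>{1..n}. grid_point (m i) (J i))"
proof -
  let ?u = "\<lambda>i\<in>{1..n}. grid_point (m i) (J i)"
  let ?t = "\<lambda>r. \<lambda>i\<in>{1..n}. transformed_value (m i) (q i) (x r i)"
  have Ji: "J i \<in> {1..m i}" if "i \<in> {1..n}" for i using J that by auto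
  \<comment> \<open>The copula is a restricted function, so its value is a relative frequency only
    at points of the grid.\<close>
  have "?u \<in> PiE {1..n} (\<lambda>i. grid (m i))"
    using Ji by (force simp: grid_def)
  moreover have "?t r = ?u \<longleftrightarrow> (\<forall>i\<in>{1..n}. x r i \<in> part_interval (q i) (J i))"
    if r: "r \<in> {1..N}" for r
  proof -
    have "transformed_value (m i) (q i) (x r i) = grid_point (m i) (J i)
        \<longleftrightarrow> x r i \<in> part_interval (q i) (J i)" if "i \<in> {1..n}" for i
      using P that range[OF r that] Ji[OF that]
      by (intro transformed_value_eq_iff[of N "sample_values N x i" "lo i" "hi i"])
        (auto simp: uniform_partitions_def)
    \<comment> \<open>Both vectors are \<open>undefined\<close> outside \<open>{1..n}\<close>, so
      agreement on the coordinates is equality of functions.\<close>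
    then show ?thesis by (auto simp: fun_eq_iff restrict_def)
  qed
  then have "{r \<in> {1..N}. ?u = ?t r} =
      {r \<in> {1..N}. \<forall>i\<in>{1..n}. x r i \<in> part_interval (q i) (J i)}"
    by (intro Collect_cong) metis
  then have "count (transformed_sample n N x m q) ?u =
      card {r \<in> {1..N}. \<forall>i\<in>{1..n}. x r i \<in> part_interval (q i) (J i)}"
    \<comment> \<open>Each index has multiplicity one in \<open>mset_set {1..N}\<close>, so the
      multiplicity of \<open>?u\<close> is the number of indices mapped to it.\<close>
    unfolding transformed_sample_def by (simp add: count_image_mset' sum.If_cases Int_def)
  ultimately show ?thesis
    by (simp add: sample_derivated_copula_def joint_freq_def)
qed

text \<open>Kept apart from the theorem so that it applies to two samples whose probability spaces
  may have different types.\<close>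

lemma information_content_eq:
  assumes N: "1 \<le> N" and S: "admissible_sample M n X N x lo hi"
    and P: "uniform_partitions n N x lo hi m q"
  shows "information_content n N x m q =
           (\<Sum>i = 1..n. log 2 (real (m i))) +
           (\<Sum>J \<in> PiE {1..n} (\<lambda>i. {1..m i}).
              sample_derivated_copula n N x m q (\<lambda>i\<in>{1..n}. grid_point (m i) (J i)) *
              log 2 (sample_derivated_copula n N x m q (\<lambda>i\<in>{1..n}. grid_point (m i) (J i))))"
proof -
  have "lo i < x r i \<and> x r i \<le> hi i" if r: "r \<in> {1..N}" and i: "i \<in> {1..n}" for r i
  proof -
    have fin: "finite (sample_values N x i)" and mem: "x r i \<in> sample_values N x i"
      using r by (auto simp: sample_values_def)
    have "lo i < Min (sample_values N x i)" "Max (sample_values N x i) < hi i"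
      using S i by (auto simp: admissible_sample_def)
    with Min_le[OF fin mem] Max_ge[OF fin mem] show ?thesis by linarith
  qed
  note joint = joint_freq_eq_copula[OF P this]
  have "marginal_entropy N x m q i = log 2 (real (m i))" if "i \<in> {1..n}" for i
    using N S P that
    by (intro marginal_entropy_eq[of _ _ _ "lo i" "hi i"])
      (auto simp: admissible_sample_def uniform_partitions_def)
  then show ?thesis
    by (simp add: information_content_def joint_entropy_def joint del: One_nat_def atLeastAtMost_iff cong: sum.cong)
qed

theorem mainTheorem2:
  fixes M :: "'a measure" and X :: "nat \<Rightarrow> 'a \<Rightarrow> real"
    and n N :: nat and x :: "nat \<Rightarrow> nat \<Rightarrow> real" and lo hi :: "nat \<Rightarrow> real"
    and m :: "nat \<Rightarrow> nat" and q :: "nat \<Rightarrow> nat \<Rightarrow> real"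
  assumes "1 \<le> n" and "1 \<le> N"
    and "admissible_sample M n X N x lo hi"
    and "uniform_partitions n N x lo hi m q"
  shows "information_content n N x m q =
           (\<Sum>i = 1..n. log 2 (real (m i))) +
           (\<Sum>J \<in> PiE {1..n} (\<lambda>i. {1..m i}).
              sample_derivated_copula n N x m q (\<lambda>i\<in>{1..n}. grid_point (m i) (J i)) *
              log 2 (sample_derivated_copula n N x m q (\<lambda>i\<in>{1..n}. grid_point (m i) (J i))))
         \<and> (\<forall>(M' :: 'b measure) X' N' x' lo' hi' q'.
              1 \<le> N' \<and> admissible_sample M' n X' N' x' lo' hi' \<and>
              uniform_partitions n N' x' lo' hi' m q' \<and>
              sample_derivated_copula n N' x' m q' = sample_derivated_copula n N x m q
              \<longrightarrow> information_content n N' x' m q' = information_content n N x m q)"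
proof (intro conjI allI impI)
  fix M' :: "'b measure" and X' N' x' lo' hi' q'
  assume "1 \<le> N' \<and> admissible_sample M' n X' N' x' lo' hi' \<and>
    uniform_partitions n N' x' lo' hi' m q' \<and>
    sample_derivated_copula n N' x' m q' = sample_derivated_copula n N x m q"
  \<comment> \<open>With \<open>n\<close> and \<open>m\<close> shared, the right side of the formula
    involves the sample only through its copula; the sizes \<open>N\<close> and \<open>N'\<close>
    may differ.\<close>
  then show "information_content n N' x' m q' = information_content n N x m q"
    using information_content_eq[OF assms(2-4)] information_content_eq[of N' M' n X' x' lo' hi' m q']
    by simp
qed (rule information_content_eq[OF assms(2-4)])

end
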